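(* Let $X,Y$ be real topological vector spaces and $\rho:X\to\mathbb{R}$ a non-zero continuous linear functional. Let $g:X\to(0,\infty)$ and $K:\mathbb{G}_\rho(X)\to Y$ be continuous with $$K(u\circ_\rho v)=K(u)+g(u)K(v)\qquad(u,v\in\mathbb{G}_\rho(X)).$$ Then the auxiliary function $g$ is $\rho$-multiplicative, i.e. $g(u\circ_\rho v)=g(u)g(v)$ for $u,v\in\mathbb{G}_\rho(X)$, and its index $\gamma:=\log g$ is $\rho$-additive, i.e. $\gamma(u\circ_\rho v)=\gamma(u)+\gamma(v)$ for $u,v\in\mathbb{G}_\rho(X)$. So, for any $u$ with $\rho(u)=1$, $$g(x)=e^{\gamma(x-\rho(x)u)}(1+\rho(x))^{\gamma(u)/\log2}\qquad(x\in\mathbb{G}_\rho(X)),$$ where $\alpha(x):=\gamma(x-\rho(x)u)$ is linear and $\alpha(u)=0$. Conversely, for any $\rho$-additive $\alpha:\mathbb{G}_\rho(X)\to\mathbb{R}$ (i.e. $\alpha(x\circ_\rho y)=\alpha(x)+\alpha(y)$) and any real parameter $\beta$, the function $$\bar g(x)=\bar g_{\alpha,\beta}(x):=e^{\alpha(x)}(1+\rho(x))^{\beta}$$ is multiplicative: $\bar g(x\circ_\rho y)=\bar g(x)\bar g(y)$ for $x,y\in\mathbb{G}_\rho(X)$.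
   Context: For a continuous linear functional $\rho:X\to\mathbb{R}$ put $u\circ_\rho v:=u+v+\rho(u)v$ and $\mathbb{G}_\rho(X):=\{x\in X:1+\rho(x)>0\}$; $(\mathbb{G}_\rho(X),\circ_\rho)$ is a group.
   Formalization: The formal statement additionally assumes that K is not identically zero on G_ρ(X); for K = 0 the equation holds for every g, and e.g. g = 2 is not ρ-multiplicative. *)

theory Defs
  imports "HOL-Analysis.Analysis"
begin

text \<open>
  Real topological vector spaces, not assumed Hausdorff. Addition and negation are continuous by
  \<^class>\<open>topological_ab_group_add\<close>; the axiom below is joint continuity of
  scalar multiplication, in the filter style of \<open>tendsto_add_Pair\<close>.
\<close>

class real_topological_vector_space = real_vector + topological_ab_group_add +
  assumes tendsto_scaleR_Pair:
    "filterlim (\<lambda>p. fst p *\<^sub>R snd p) (nhds (c *\<^sub>R x)) (nhds c \<times>\<^sub>F nhds x)"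

instance real_normed_vector \<subseteq> real_topological_vector_space
proof
  fix c :: real and x :: 'a
  show "filterlim (\<lambda>p. fst p *\<^sub>R snd p) (nhds (c *\<^sub>R x)) (nhds c \<times>\<^sub>F nhds x)"
    by (intro tendsto_scaleR filterlim_fst filterlim_snd)
qed

definition popa_op :: "('a::real_vector \<Rightarrow> real) \<Rightarrow> 'a \<Rightarrow> 'a \<Rightarrow> 'a" where
  "popa_op \<rho> u v = u + v + \<rho> u *\<^sub>R v"

definition popa_group :: "('a \<Rightarrow> real) \<Rightarrow> 'a set" where
  "popa_group \<rho> = {x. 1 + \<rho> x > 0}"

definition rho_multiplicative :: "('a::real_vector \<Rightarrow> real) \<Rightarrow> ('a \<Rightarrow> real) \<Rightarrow> bool" where
  "rho_multiplicative \<rho> g \<longleftrightarrow>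
    (\<forall>u\<in>popa_group \<rho>. \<forall>v\<in>popa_group \<rho>. g (popa_op \<rho> u v) = g u * g v)"

definition rho_additive :: "('a::real_vector \<Rightarrow> real) \<Rightarrow> ('a \<Rightarrow> real) \<Rightarrow> bool" where
  "rho_additive \<rho> f \<longleftrightarrow>
    (\<forall>u\<in>popa_group \<rho>. \<forall>v\<in>popa_group \<rho>. f (popa_op \<rho> u v) = f u + f v)"

end

theory Submission
  imports Defs
begin

text \<open>
  Comparing the two bracketings of \<open>K (u \<circ> v \<circ> w)\<close> at a point \<open>w\<close> with \<open>K w \<noteq> 0\<close> shows that \<open>g\<close>
  is multiplicative. The continuous additive index \<open>\<gamma>\<close> then splits along
  \<open>x = (x - \<rho> x u) \<circ> (\<rho> x u)\<close>: on the kernel of \<open>\<rho>\<close> the operation is vector addition, so \<open>\<gamma>\<close> is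
  linear there, while \<open>s \<mapsto> (exp s - 1) u\<close> embeds the reals as a one-parameter subgroup, so
  Cauchy's functional equation gives \<open>\<gamma>\<close> on the line through \<open>u\<close> as a multiple of \<open>ln (1 + \<rho> x)\<close>.
\<close>

text \<open>Cauchy's functional equation: additivity gives integer homogeneity, clearing
  denominators gives \<open>f q = q * f 1\<close> for rational \<open>q\<close>, and continuity
  carries this to the closure of the rationals, the whole line.\<close>

lemma continuous_additive_real:
  fixes f :: "real \<Rightarrow> real"
  assumes cont: "continuous_on UNIV f" and add: "\<And>s t. f (s + t) = f s + f t"
  shows "f t = t * f 1"
proof -
  have zero: "f 0 = 0"
    using add[of 0 0] by simp
  have neg: "f (- x) = - f x" for x
    using add[of "- x" x] zero by simp
  have of_nat: "f (of_nat n * x) = of_nat n * f x" for n x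
    by (induction n) (simp_all add: zero add distrib_right)
  have of_int: "f (of_int i * x) = of_int i * f x" for i x
    by (cases i) (simp_all only: of_int_of_nat_eq of_int_minus mult_minus_left neg of_nat)
  have rat: "f q - q * f 1 = 0" if "q \<in> \<rat>" for q
  proof -
    from that obtain a b :: int where "b \<noteq> 0" and q: "q = of_int a / of_int b"
      unfolding Rats_eq_int_div_int by blast
    then have "of_int b * f q = of_int a * f 1"
      using of_int[of b q] of_int[of a 1] by simp
    then show ?thesis
      using \<open>b \<noteq> 0\<close> by (simp add: q field_simps)
  qed
  have "f t - t * f 1 = 0"
  proof (rule continuous_constant_on_closure[OF _ rat])
    show "continuous_on (closure \<rat>) (\<lambda>q. f q - q * f 1)"
      by (intro continuous_intros continuous_on_subset[OF cont]) simp
  qed (simp_all add: Rats_closure_real)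
  then show ?thesis by simp
qed

text \<open>Joint continuity of scaling, composed with \<open>s \<mapsto> (c s, a)\<close>. This
  later makes \<open>\<gamma>\<close> continuous along lines.\<close>

lemma continuous_on_scaleR_const:
  fixes a :: "'a::real_topological_vector_space"
  assumes "continuous_on S c"
  shows "continuous_on S (\<lambda>s. c s *\<^sub>R a)"
  unfolding continuous_on_def
proof
  fix s assume "s \<in> S"
  then have "(c \<longlongrightarrow> c s) (at s within S)"
    using assms by (simp add: continuous_on_def)
  then show "((\<lambda>s. c s *\<^sub>R a) \<longlongrightarrow> c s *\<^sub>R a) (at s within S)"
    using filterlim_compose[OF tendsto_scaleR_Pair, of "\<lambda>s. (c s, a)"]
    by (simp add: filterlim_Pair)
qed

text \<open>Linearity of \<open>\<rho>\<close> makes \<open>1 + \<rho>\<close> multiplicative for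
  the operation; closure follows because a product of positive reals is positive.\<close>

lemma popa_op_in_popa_group:
  assumes "linear \<rho>" "u \<in> popa_group \<rho>" "v \<in> popa_group \<rho>"
  shows "1 + \<rho> (popa_op \<rho> u v) = (1 + \<rho> u) * (1 + \<rho> v)"
    and "popa_op \<rho> u v \<in> popa_group \<rho>"
proof -
  show eq: "1 + \<rho> (popa_op \<rho> u v) = (1 + \<rho> u) * (1 + \<rho> v)"
    using assms(1) by (simp add: popa_op_def linear_add linear_scale algebra_simps)
  then show "popa_op \<rho> u v \<in> popa_group \<rho>"
    using assms(2,3) by (simp only: popa_group_def mem_Collect_eq zero_less_mult_iff) simp
qed

lemma popa_op_assoc:
  assumes "linear \<rho>"
  shows "popa_op \<rho> (popa_op \<rho> u v) w = popa_op \<rho> u (popa_op \<rho> v w)"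
  using assms by (simp add: popa_op_def linear_add linear_scale algebra_simps)

lemma rho_multiplicative_if_cocycle:
  fixes K :: "'x::real_vector \<Rightarrow> 'y::real_vector"
  assumes lin: "linear \<rho>" and w: "w \<in> popa_group \<rho>" "K w \<noteq> 0"
    and K: "\<And>u v. u \<in> popa_group \<rho> \<Longrightarrow> v \<in> popa_group \<rho> \<Longrightarrow>
      K (popa_op \<rho> u v) = K u + g u *\<^sub>R K v"
  shows "rho_multiplicative \<rho> g"
  unfolding rho_multiplicative_def
proof (intro ballI)
  fix u v assume uv: "u \<in> popa_group \<rho>" "v \<in> popa_group \<rho>"
  note mem = popa_op_in_popa_group(2)[OF lin]
  have "K (popa_op \<rho> (popa_op \<rho> u v) w) = K u + g u *\<^sub>R K v + g (popa_op \<rho> u v) *\<^sub>R K w"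
    by (simp add: K mem uv w)
  moreover have "K (popa_op \<rho> u (popa_op \<rho> v w)) = K u + g u *\<^sub>R K v + (g u * g v) *\<^sub>R K w"
    by (simp add: K mem uv w scaleR_add_right)
  \<comment> \<open>By associativity the two expansions agree. Their first two terms cancel, leaving
    an equality of multiples of the nonzero vector \<open>K w\<close>.\<close>
  ultimately show "g (popa_op \<rho> u v) = g u * g v"
    using w by (simp add: popa_op_assoc[OF lin])
qed

text \<open>A product of two homomorphisms into the positive reals: the exponential of an additive
  map, and a power of the homomorphism \<open>1 + \<rho>\<close>.\<close>

lemma rho_multiplicative_exp_powr:
  assumes "linear \<rho>" "rho_additive \<rho> \<alpha>"
  shows "rho_multiplicative \<rho> (\<lambda>x. exp (\<alpha> x) * (1 + \<rho> x) powr \<beta>)"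
  unfolding rho_multiplicative_def
proof (intro ballI)
  fix u v assume uv: "u \<in> popa_group \<rho>" "v \<in> popa_group \<rho>"
  then have "\<alpha> (popa_op \<rho> u v) = \<alpha> u + \<alpha> v"
    using assms(2) by (simp add: rho_additive_def)
  moreover have "0 < 1 + \<rho> u" "0 < 1 + \<rho> v"
    using uv by (simp_all add: popa_group_def)
  ultimately show "exp (\<alpha> (popa_op \<rho> u v)) * (1 + \<rho> (popa_op \<rho> u v)) powr \<beta> =
      exp (\<alpha> u) * (1 + \<rho> u) powr \<beta> * (exp (\<alpha> v) * (1 + \<rho> v) powr \<beta>)"
    by (simp add: popa_op_in_popa_group(1)[OF assms(1) uv] exp_add powr_mult)
qed

context
  fixes \<rho> \<gamma> :: "'x::real_topological_vector_space \<Rightarrow> real"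
  assumes lin: "linear \<rho>" and cont: "continuous_on UNIV \<gamma>" and add: "rho_additive \<rho> \<gamma>"
begin

lemma rho_additive_on_kernel:
  assumes "\<rho> a = 0" "\<rho> b = 0"
  shows "\<gamma> (a + b) = \<gamma> a + \<gamma> b"
proof -
  have "a \<in> popa_group \<rho>" "b \<in> popa_group \<rho>" "popa_op \<rho> a b = a + b"
    using assms by (simp_all add: popa_group_def popa_op_def)
  then show ?thesis
    using add unfolding rho_additive_def by metis
qed

text \<open>On the line through \<open>a\<close>, which lies in the kernel,
  \<open>s \<mapsto> \<gamma> (s *\<^sub>R a)\<close> is a continuous additive function of a real
  variable, so Cauchy's equation applies.\<close>

lemma rho_additive_scaleR_kernel:
  assumes "\<rho> a = 0"
  shows "\<gamma> (t *\<^sub>R a) = t * \<gamma> a"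
proof -
  have "continuous_on UNIV (\<lambda>s. \<gamma> (s *\<^sub>R a))"
    by (intro continuous_on_compose2[OF cont] continuous_on_scaleR_const continuous_intros) auto
  then show ?thesis
    using continuous_additive_real[of "\<lambda>s. \<gamma> (s *\<^sub>R a)" t]
    by (simp add: scaleR_add_left rho_additive_on_kernel linear_scale[OF lin] assms)
qed

text \<open>Since \<open>\<rho> u = 1\<close>, the map
  \<open>x \<mapsto> x - \<rho> x *\<^sub>R u\<close> is a linear projection onto the kernel of
  \<open>\<rho>\<close>, where \<open>\<gamma>\<close> is additive and homogeneous.\<close>

lemma linear_rho_additive_projection:
  assumes u: "\<rho> u = 1"
  shows "linear (\<lambda>x. \<gamma> (x - \<rho> x *\<^sub>R u))"
proof
  have ker: "\<rho> (x - \<rho> x *\<^sub>R u) = 0" for x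
    by (simp add: linear_diff[OF lin] linear_scale[OF lin] u)
  show "\<gamma> (x + y - \<rho> (x + y) *\<^sub>R u) = \<gamma> (x - \<rho> x *\<^sub>R u) + \<gamma> (y - \<rho> y *\<^sub>R u)" for x y
    using rho_additive_on_kernel[OF ker[of x] ker[of y]]
    by (simp add: linear_add[OF lin] algebra_simps)
  show "\<gamma> (r *\<^sub>R x - \<rho> (r *\<^sub>R x) *\<^sub>R u) = r *\<^sub>R \<gamma> (x - \<rho> x *\<^sub>R u)" for r x
    using rho_additive_scaleR_kernel[OF ker[of x], of r]
    by (simp add: linear_scale[OF lin] algebra_simps)
qed

lemma rho_additive_scaleR:
  assumes u: "\<rho> u = 1" and r: "1 + r > 0"
  shows "\<gamma> (r *\<^sub>R u) = ln (1 + r) * (\<gamma> u / ln 2)"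
proof -
  define h where "h s = \<gamma> ((exp s - 1) *\<^sub>R u)" for s :: real
  have "continuous_on UNIV h"
    unfolding h_def
    by (intro continuous_on_compose2[OF cont] continuous_on_scaleR_const continuous_intros) auto
  moreover have "h (s + t) = h s + h t" for s t
  proof -
    \<comment> \<open>With \<open>p = exp s - 1\<close> and \<open>q = exp t - 1\<close>, the
      coefficient of \<open>u\<close> is
      \<open>p + q + p * q = (1 + p) * (1 + q) - 1\<close>.\<close>
    have "popa_op \<rho> ((exp s - 1) *\<^sub>R u) ((exp t - 1) *\<^sub>R u) = (exp (s + t) - 1) *\<^sub>R u"
      by (simp add: popa_op_def linear_scale[OF lin] u exp_add
          flip: scaleR_add_left) (simp add: algebra_simps)
    moreover have "(exp s - 1) *\<^sub>R u \<in> popa_group \<rho>" for s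
      by (simp add: popa_group_def linear_scale[OF lin] u)
    ultimately show ?thesis
      using add unfolding h_def rho_additive_def by metis
  qed
  ultimately have h: "h s = s * h 1" for s
    by (rule continuous_additive_real)
  \<comment> \<open>The parameter \<open>s = ln 2\<close> gives coefficient
    \<open>exp s - 1 = 1\<close>, that is the vector \<open>u\<close> itself; hence the denominator
    \<open>ln 2\<close>.\<close>
  have "\<gamma> u = ln 2 * h 1"
    using h[of "ln 2"] by (simp add: h_def)
  moreover have "\<gamma> (r *\<^sub>R u) = ln (1 + r) * h 1"
    using h[of "ln (1 + r)"] r by (simp add: h_def)
  ultimately show ?thesis by simp
qed

lemma rho_additive_decomposition:
  assumes u: "\<rho> u = 1" and x: "x \<in> popa_group \<rho>"
  shows "\<gamma> x = \<gamma> (x - \<rho> x *\<^sub>R u) + ln (1 + \<rho> x) * (\<gamma> u / ln 2)"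
proof -
  let ?a = "x - \<rho> x *\<^sub>R u"
  have "\<rho> ?a = 0"
    by (simp add: linear_diff[OF lin] linear_scale[OF lin] u)
  \<comment> \<open>The factor \<open>?a\<close> stands on the left so that the twisting term
    \<open>\<rho> ?a *\<^sub>R (\<rho> x *\<^sub>R u)\<close> vanishes.\<close>
  then have "popa_op \<rho> ?a (\<rho> x *\<^sub>R u) = x" "?a \<in> popa_group \<rho>"
    by (simp_all add: popa_op_def popa_group_def)
  moreover have "\<rho> x *\<^sub>R u \<in> popa_group \<rho>"
    using x by (simp add: popa_group_def linear_scale[OF lin] u)
  ultimately have "\<gamma> x = \<gamma> ?a + \<gamma> (\<rho> x *\<^sub>R u)"
    using add unfolding rho_additive_def by metis
  then show ?thesis
    using x rho_additive_scaleR[OF u, of "\<rho> x"] by (simp add: popa_group_def)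
qed

end

text \<open>The assumption that \<open>K\<close> is not identically zero on the group excludes the
  trivial solution \<open>K = 0\<close>, which satisfies the equation for every \<open>g\<close> and
  so says nothing about \<open>g\<close>.\<close>

theorem theorem2p1:
  fixes \<rho> :: "'x::real_topological_vector_space \<Rightarrow> real"
  assumes "linear \<rho>" and "continuous_on UNIV \<rho>" and "\<exists>x. \<rho> x \<noteq> 0"
  shows
    "(\<forall>(g :: 'x \<Rightarrow> real) (K :: 'x \<Rightarrow> 'y::real_topological_vector_space).
        (\<forall>x. g x > 0) \<longrightarrow> continuous_on UNIV g \<longrightarrow>
        continuous_on (popa_group \<rho>) K \<longrightarrow> (\<exists>w\<in>popa_group \<rho>. K w \<noteq> 0) \<longrightarrow>
        (\<forall>u\<in>popa_group \<rho>. \<forall>v\<in>popa_group \<rho>. K (popa_op \<rho> u v) = K u + g u *\<^sub>R K v) \<longrightarrow>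
        (let \<gamma> = (\<lambda>x. ln (g x)) in
          rho_multiplicative \<rho> g \<and> rho_additive \<rho> \<gamma> \<and>
          (\<forall>u. \<rho> u = 1 \<longrightarrow>
            (\<forall>x\<in>popa_group \<rho>.
              g x = exp (\<gamma> (x - \<rho> x *\<^sub>R u)) * (1 + \<rho> x) powr (\<gamma> u / ln 2)) \<and>
            (let \<alpha> = (\<lambda>x. \<gamma> (x - \<rho> x *\<^sub>R u)) in linear \<alpha> \<and> \<alpha> u = 0))))
     \<and> (\<forall>(\<alpha> :: 'x \<Rightarrow> real) (\<beta> :: real). rho_additive \<rho> \<alpha> \<longrightarrow>
          rho_multiplicative \<rho> (\<lambda>x. exp (\<alpha> x) * (1 + \<rho> x) powr \<beta>))"
proof (intro conjI allI impI)
  fix g :: "'x \<Rightarrow> real" and K :: "'x \<Rightarrow> 'y"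
  assume pos: "\<forall>x. g x > 0" and g: "continuous_on UNIV g"
    and "\<exists>w\<in>popa_group \<rho>. K w \<noteq> 0"
    and "\<forall>u\<in>popa_group \<rho>. \<forall>v\<in>popa_group \<rho>. K (popa_op \<rho> u v) = K u + g u *\<^sub>R K v"
  then have mult: "rho_multiplicative \<rho> g"
    using rho_multiplicative_if_cocycle[OF assms(1)] by blast
  define \<gamma> where "\<gamma> x = ln (g x)" for x
  have nonzero: "g x \<noteq> 0" for x
    using pos by (metis less_irrefl)
  then have cont: "continuous_on UNIV \<gamma>"
    unfolding \<gamma>_def by (intro continuous_intros g) simp
  have add: "rho_additive \<rho> \<gamma>"
    using mult pos by (simp add: rho_additive_def rho_multiplicative_def \<gamma>_def ln_mult_pos)
  have formula: "g x = exp (\<gamma> (x - \<rho> x *\<^sub>R u)) * (1 + \<rho> x) powr (\<gamma> u / ln 2)"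
    if u: "\<rho> u = 1" and x: "x \<in> popa_group \<rho>" for u x
  proof -
    have "g x = exp (\<gamma> x)"
      using pos by (simp add: \<gamma>_def)
    also have "\<dots> = exp (\<gamma> (x - \<rho> x *\<^sub>R u)) * exp (\<gamma> u / ln 2 * ln (1 + \<rho> x))"
      by (subst rho_additive_decomposition[OF assms(1) cont add u x])
        (simp add: exp_add mult.commute)
    also have "exp (\<gamma> u / ln 2 * ln (1 + \<rho> x)) = (1 + \<rho> x) powr (\<gamma> u / ln 2)"
      using x by (simp add: powr_def popa_group_def)
    finally show ?thesis .
  qed
  have linear: "linear (\<lambda>x. \<gamma> (x - \<rho> x *\<^sub>R u))" if "\<rho> u = 1" for u
    using linear_rho_additive_projection[OF assms(1) cont add that] .
  \<comment> \<open>The argument of \<open>\<gamma>\<close> is the zero vector here, and evaluating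
    the linear map at zero gives \<open>\<gamma> 0 = 0\<close>.\<close>
  have vanish: "\<gamma> (u - \<rho> u *\<^sub>R u) = 0" if "\<rho> u = 1" for u
    using linear_0[OF linear[OF that]] linear_0[OF assms(1)] that by simp
  show "let \<gamma> = (\<lambda>x. ln (g x)) in
      rho_multiplicative \<rho> g \<and> rho_additive \<rho> \<gamma> \<and>
      (\<forall>u. \<rho> u = 1 \<longrightarrow>
        (\<forall>x\<in>popa_group \<rho>.
          g x = exp (\<gamma> (x - \<rho> x *\<^sub>R u)) * (1 + \<rho> x) powr (\<gamma> u / ln 2)) \<and>
        (let \<alpha> = (\<lambda>x. \<gamma> (x - \<rho> x *\<^sub>R u)) in linear \<alpha> \<and> \<alpha> u = 0))"
    unfolding Let_def \<gamma>_def[symmetric]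
    using mult add formula linear vanish by blast
next
  fix \<alpha> :: "'x \<Rightarrow> real" and \<beta> :: real
  assume "rho_additive \<rho> \<alpha>"
  then show "rho_multiplicative \<rho> (\<lambda>x. exp (\<alpha> x) * (1 + \<rho> x) powr \<beta>)"
    by (rule rho_multiplicative_exp_powr[OF assms(1)])
qed

end
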